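(* For all integers $d, n$ with $1 \leq d \leq n$, the maximum diameter $\Delta(d,n)$ of a $d$-dimensional polyhedron with $n$ facets satisfies $$\Delta(d,n) \leq (n-d)^{\log_2 (d)},$$ where in the case $d = n = 1$ (in which the right-hand side is the expression $0^0$) the assertion is that $\Delta(1,1) = 0$.
   Context: A $d$-polyhedron $P$ is a $d$-dimensional set in $\mathbb{R}^d$ that is the intersection of a finite number of half-spaces of the form $H = \{x \in \mathbb{R}^d : a^T x \leq \beta\}$ with $0 \neq a \in \mathbb{R}^d$, $\beta \in \mathbb{R}$; it need not be bounded. If $P$ can be written as the intersection of $n$ such half-spaces but not fewer, $P$ is said to have $n$ facets and is called a $(d,n)$-polyhedron. A point $v \in P$ is a vertex of $P$ if there is a half-space $H$ with $P \cap H = \{v\}$. Two distinct vertices $v$ and $w$ of $P$ are adjacent if there is a half-space $H$ with $P \cap H = [v,w] := \{(1-\lambda)v + \lambda w : 0 \leq \lambda \leq 1\}$. A path of length $k$ from vertex $v$ to vertex $w$ in $P$ is a sequence $v = v_0, v_1, \dots, v_k = w$ of vertices of $P$ with $v_{i-1}$ and $v_i$ adjacent for $i = 1, \dots, k$. The distance $\rho_P(v,w)$ is the length of a shortest path from $v$ to $w$ in $P$. The diameter of $P$ is $$\delta(P) := \max\{\rho_P(v,w) : v \text{ and } w \text{ vertices of } P\},$$ and $$\Delta(d,n) := \max\{\delta(P) : P \text{ a } (d,n)\text{-polyhedron}\}.$$ A maximum over an empty set is taken to be $0$ (this concerns polyhedra without vertices, and pairs $(d,n)$ for which no $(d,n)$-polyhedron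 exists, such as $d=1$, $n\geq 3$); thus the bound $\Delta(d,n) \leq B$ means that $\rho_P(v,w) \leq B$ for every $(d,n)$-polyhedron $P$ and all vertices $v,w$ of $P$. For $d=n\ge 2$ the right-hand side of the bound is $0^{\log_2(d)} = 0$. *)

theory Defs
  imports "HOL-Analysis.Analysis"
begin

definition halfspace :: "'a::euclidean_space set \<Rightarrow> bool" where
  "halfspace H \<longleftrightarrow> (\<exists>a b. a \<noteq> 0 \<and> H = {x. a \<bullet> x \<le> b})"

definition Inter_of_halfspaces :: "nat \<Rightarrow> 'a::euclidean_space set \<Rightarrow> bool" where
  "Inter_of_halfspaces n P \<longleftrightarrow>
     (\<exists>F. finite F \<and> card F = n \<and> (\<forall>H\<in>F. halfspace H) \<and> P = \<Inter>F)"

definition full_dim_polyhedron :: "'a::euclidean_space set \<Rightarrow> bool" where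
  "full_dim_polyhedron P \<longleftrightarrow> polyhedron P \<and> aff_dim P = int DIM('a)"

text \<open>The \<open>(d,n)\<close>-polyhedra, where \<open>d\<close> is the dimension of the ambient space.\<close>

definition dn_polyhedron :: "nat \<Rightarrow> 'a::euclidean_space set \<Rightarrow> bool" where
  "dn_polyhedron n P \<longleftrightarrow>
     full_dim_polyhedron P \<and> Inter_of_halfspaces n P \<and>
     (\<forall>m<n. \<not> Inter_of_halfspaces m P)"

definition vertex :: "'a::euclidean_space set \<Rightarrow> 'a \<Rightarrow> bool" where
  "vertex P v \<longleftrightarrow> v \<in> P \<and> (\<exists>H. halfspace H \<and> P \<inter> H = {v})"

definition adjacent :: "'a::euclidean_space set \<Rightarrow> 'a \<Rightarrow> 'a \<Rightarrow> bool" where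
  "adjacent P v w \<longleftrightarrow>
     vertex P v \<and> vertex P w \<and> v \<noteq> w \<and>
     (\<exists>H. halfspace H \<and> P \<inter> H = closed_segment v w)"

definition vertex_path :: "'a::euclidean_space set \<Rightarrow> nat \<Rightarrow> 'a \<Rightarrow> 'a \<Rightarrow> bool" where
  "vertex_path P k v w \<longleftrightarrow>
     (\<exists>p :: nat \<Rightarrow> 'a. p 0 = v \<and> p k = w \<and> (\<forall>i\<le>k. vertex P (p i)) \<and>
        (\<forall>i\<in>{1..k}. adjacent P (p (i - 1)) (p i)))"

text \<open>
  Distances and diameters live in \<^typ>\<open>enat\<close>: the distance is \<open>\<infinity>\<close> if there is no path, the
  supremum of the empty set is \<open>0\<close>, and a nonempty set with a finite supremum attains it. So a
  finite bound on these suprema is a bound on the corresponding maxima.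
\<close>

definition vertex_dist :: "'a::euclidean_space set \<Rightarrow> 'a \<Rightarrow> 'a \<Rightarrow> enat" where
  "vertex_dist P v w = Inf {enat k |k. vertex_path P k v w}"

definition poly_diameter :: "'a::euclidean_space set \<Rightarrow> enat" where
  "poly_diameter P = Sup {vertex_dist P v w |v w. vertex P v \<and> vertex P w}"

text \<open>The dimension is passed as an index type of cardinality \<open>d\<close>.\<close>

definition max_diameter :: "'d::finite itself \<Rightarrow> nat \<Rightarrow> enat" where
  "max_diameter _ n = Sup {poly_diameter P |P :: (real^'d) set. dn_polyhedron n P}"

end

theory Submission
  imports Defs
begin

text \<open>
The proof combines the recurrence of Kalai and Kleitman with the estimate of Todd.

Let \<open>v\<close> and \<open>w\<close> be vertices of a polyhedron given by \<open>n\<close> inequalities in dimension \<open>d\<close>. Walk away from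
\<open>v\<close> and collect the inequalities that are tight at some vertex met so far. As long as only \<open>m\<close> of them have
been collected, the distances from \<open>v\<close> covered so far are the same as in the polyhedron defined by these \<open>m\<close> inequalities
alone (lemma \<open>distance_le_relaxed_diameter\<close>): an edge of the larger polyhedron that left the original one
would hit a new inequality on its way (lemma \<open>edge_relaxation\<close>). So the number of steps is bounded by the
diameter for \<open>m\<close> inequalities. Doing this from \<open>v\<close> with \<open>m = n div 2\<close>, from \<open>w\<close> with
\<open>m = (n - 1) div 2\<close>, and going one step further in each case, one collects more than \<open>n\<close> inequalities in
total, so the two collections share one. Its facet contains a vertex near \<open>v\<close> and one near \<open>w\<close>; inside the
facet, a polyhedron of dimension \<open>d - 1\<close> with at most \<open>n - 1\<close> inequalities, they are joined by induction
(lemma \<open>diameter_recurrence\<close>). If \<open>m < d\<close>, no steps are needed, because \<open>d\<close> inequalities are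
tight at every vertex.

The argument needs some path from \<open>v\<close> to \<open>w\<close> to begin with. It exists because from every vertex that does not
minimize a linear function bounded below there is an edge along which the function decreases
(lemmas \<open>improving_edge\<close> and \<open>extreme_points_connected\<close>).

That \<open>(n - d) powr log 2 d\<close> satisfies the recurrence is lemma \<open>todd_recurrence\<close>. Writing \<open>N = n - d\<close>, halving
divides \<open>N powr log 2 d\<close> by \<open>d\<close>, so the two half-size terms take up at most \<open>2 / d\<close> of the bound, even
with the two additional steps, which are paid for by halving \<open>N - d\<close> rather than \<open>N\<close>. Replacing \<open>d\<close> by
\<open>d - 1\<close> multiplies the bound by \<open>(1 - 1 / d) powr log 2 N\<close>. For \<open>d \<ge> 3\<close> and \<open>N \<ge> 8\<close> this factor is at most
\<open>(1 - 1 / d) ^ 3\<close>, hence at most \<open>1 - 2 / d\<close>; for \<open>d = 2\<close> and for small \<open>N\<close> the numbers are compared directly.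
\<close>

section \<open>Systems of inequalities, vertices and edges\<close>

text \<open>
Bounds on the combinatorial data of a polyhedron are proved for solution sets of finite systems of
inequalities inside an affine subspace \<open>A\<close>. Allowing \<open>A\<close> to be a proper subspace lets a facet be
treated as a system of the same kind, with the equation of the facet absorbed into the subspace, so
that induction on the dimension stays inside one ambient type.
\<close>

definition feasible :: "'a::euclidean_space set \<Rightarrow> ('a \<times> real) set \<Rightarrow> 'a set" where
  "feasible A I = {x \<in> A. \<forall>a b. (a, b) \<in> I \<longrightarrow> a \<bullet> x \<le> b}"

definition tight :: "('a::euclidean_space \<times> real) set \<Rightarrow> 'a \<Rightarrow> ('a \<times> real) set" where
  "tight I x = {(a, b). (a, b) \<in> I \<and> a \<bullet> x = b}"

text \<open>
Edges are taken as one-dimensional faces in the sense of convex geometry rather than as sections by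
a half-space: faces of faces are again faces, whereas the half-space cutting out an edge of a facet
would have to be tilted to cut out the same edge of the whole polyhedron. The two notions
are compared only at the end.
\<close>

definition edges :: "'a::euclidean_space set \<Rightarrow> ('a \<times> 'a) set" where
  "edges P = {(x, y). x extreme_point_of P \<and> y extreme_point_of P \<and> x \<noteq> y \<and>
     closed_segment x y face_of P}"

lemma in_tight: "(a, b) \<in> tight I x \<longleftrightarrow> (a, b) \<in> I \<and> a \<bullet> x = b"
  by (simp add: tight_def)

lemma tight_subset: "tight I x \<subseteq> I"
  by (auto simp: tight_def)

lemma ray_in_segment:
  fixes x u :: "'a::real_vector"
  assumes "0 \<le> s" "s \<le> t"
  shows "x + s *\<^sub>R u \<in> closed_segment x (x + t *\<^sub>R u)"
proof (cases "t = 0")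
  case False
  have "(1 - s / t) *\<^sub>R x + (s / t) *\<^sub>R (x + t *\<^sub>R u) = x + (s / t * t) *\<^sub>R u"
    by (simp add: algebra_simps)
  also have "s / t * t = s" using False by simp
  finally have "x + s *\<^sub>R u = (1 - s / t) *\<^sub>R x + (s / t) *\<^sub>R (x + t *\<^sub>R u)" ..
  moreover have "0 \<le> s / t" "s / t \<le> 1" using assms False by (auto simp: divide_le_eq_1)
  ultimately show ?thesis unfolding in_segment by blast
qed (use assms in auto)

lemma feasible_eq_Inter: "feasible A I = A \<inter> (\<Inter>p\<in>I. {x. fst p \<bullet> x \<le> snd p})"
  by (force simp: feasible_def)

lemma polyhedron_feasible:
  assumes "affine A" "finite I"
  shows "polyhedron (feasible A I)"
  unfolding feasible_eq_Inter
  by (rule polyhedron_Int[OF affine_imp_polyhedron[OF assms(1)]], rule polyhedron_Inter)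
    (use assms in \<open>auto simp: polyhedron_halfspace_le\<close>)

lemma convex_feasible: "affine A \<Longrightarrow> finite I \<Longrightarrow> convex (feasible A I)"
  by (simp add: polyhedron_imp_convex polyhedron_feasible)

lemma slack_move:
  fixes x u :: "'a::euclidean_space"
  assumes "finite I" "\<And>a b. (a, b) \<in> I \<Longrightarrow> a \<bullet> x < b"
  obtains e where "e > 0" "\<And>a b t. (a, b) \<in> I \<Longrightarrow> \<bar>t\<bar> \<le> e \<Longrightarrow> a \<bullet> (x + t *\<^sub>R u) \<le> b"
proof -
  have "\<exists>e>0. \<forall>a b t. (a, b) \<in> I \<longrightarrow> \<bar>t\<bar> \<le> e \<longrightarrow> a \<bullet> (x + t *\<^sub>R u) \<le> b"
    using assms
  proof (induction I rule: finite_induct)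
    case empty
    show ?case by (rule exI[of _ 1]) auto
  next
    case (insert p I)
    obtain a0 b0 where p: "p = (a0, b0)" by (cases p)
    obtain e where e: "e > 0" "\<forall>a b t. (a, b) \<in> I \<longrightarrow> \<bar>t\<bar> \<le> e \<longrightarrow> a \<bullet> (x + t *\<^sub>R u) \<le> b"
      using insert by (metis insertCI)
    define f where "f = (b0 - a0 \<bullet> x) / (\<bar>a0 \<bullet> u\<bar> + 1)"
    have gap: "a0 \<bullet> x < b0" using insert.prems p by auto
    then have f: "f > 0" by (simp add: f_def)
    have "a0 \<bullet> (x + t *\<^sub>R u) \<le> b0" if t: "\<bar>t\<bar> \<le> f" for t
    proof -
      have "t * (a0 \<bullet> u) \<le> \<bar>t\<bar> * \<bar>a0 \<bullet> u\<bar>" by (metis abs_ge_self abs_mult)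
      also have "\<dots> \<le> f * (\<bar>a0 \<bullet> u\<bar> + 1)" using t f by (intro mult_mono) auto
      also have "\<dots> = b0 - a0 \<bullet> x" by (simp add: f_def)
      finally show ?thesis by (simp add: inner_add_right)
    qed
    then show ?case using e f p by (intro exI[of _ "min e f"]) auto
  qed
  then show ?thesis using that by blast
qed

text \<open>
Near \<open>x\<close> only the tight constraints matter: if another point \<open>y\<close> of the subspace meets them all with
equality, then \<open>x\<close> can be moved both towards and away from \<open>y\<close>. Hence whether a feasible
point is a vertex depends on its tight constraints alone, and so survives the removal of slack ones.
\<close>

lemma extreme_point_feasible_iff:
  assumes A: "affine A" and I: "finite I"
  shows "x extreme_point_of feasible A I \<longleftrightarrow>
    x \<in> feasible A I \<and> (\<forall>y\<in>A. (\<forall>a b. (a, b) \<in> tight I x \<longrightarrow> a \<bullet> y = b) \<longrightarrow> y = x)"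
    (is "?L \<longleftrightarrow> ?R")
proof
  assume L: ?L
  then have x: "x \<in> feasible A I" by (simp add: extreme_point_of_def)
  have "y = x" if y: "y \<in> A" "\<forall>a b. (a, b) \<in> tight I x \<longrightarrow> a \<bullet> y = b" for y
  proof (rule ccontr)
    assume ne: "y \<noteq> x"
    have slack: "a \<bullet> x < b" if "(a, b) \<in> I - tight I x" for a b
      using that x by (simp add: feasible_def in_tight less_le)
    obtain e where e: "e > 0"
      "\<And>a b t. (a, b) \<in> I - tight I x \<Longrightarrow> \<bar>t\<bar> \<le> e \<Longrightarrow> a \<bullet> (x + t *\<^sub>R (y - x)) \<le> b"
      using slack_move[OF finite_Diff[OF I] slack, of "tight I x" "y - x"] by metis
    have xA: "x \<in> A" using x by (simp add: feasible_def)
    have mem: "x + t *\<^sub>R (y - x) \<in> feasible A I" if t: "\<bar>t\<bar> \<le> e" for t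
    proof -
      have "a \<bullet> (x + t *\<^sub>R (y - x)) \<le> b" if ab: "(a, b) \<in> I" for a b
      proof (cases "(a, b) \<in> tight I x")
        case True
        then have "a \<bullet> x = b" "a \<bullet> y = b" using y by (auto simp: in_tight)
        then show ?thesis by (simp add: inner_add_right inner_diff_right)
      qed (use e(2) ab t in blast)
      then show ?thesis using mem_affine_3_minus[OF A xA y(1) xA] by (simp add: feasible_def)
    qed
    have mid: "x = midpoint (x + e *\<^sub>R (y - x)) (x + (-e) *\<^sub>R (y - x))"
      by (simp add: midpoint_def)
    have "x \<in> open_segment (x + e *\<^sub>R (y - x)) (x + (-e) *\<^sub>R (y - x))"
    proof -
      have "(2 * e) *\<^sub>R (y - x) \<noteq> 0" using e ne by simp
      then have "x + e *\<^sub>R (y - x) \<noteq> x + (-e) *\<^sub>R (y - x)"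
        by (metis add_left_cancel add_diff_cancel_left' diff_minus_eq_add eq_iff_diff_eq_0 mult_2 scaleR_left_diff_distrib)
      then show ?thesis by (subst mid) simp
    qed
    then show False
      using L mem[of e] mem[of "-e"] e by (auto simp: extreme_point_of_def)
  qed
  then show ?R using x by blast
next
  assume R: ?R
  have "x \<notin> open_segment y z" if y: "y \<in> feasible A I" and z: "z \<in> feasible A I" for y z
  proof
    assume "x \<in> open_segment y z"
    then obtain u where u: "0 < u" "u < 1" "x = (1 - u) *\<^sub>R y + u *\<^sub>R z" and ne: "y \<noteq> z"
      by (auto simp: in_segment)
    have "a \<bullet> y = b" if ab: "(a, b) \<in> tight I x" for a b
    proof -
      have 1: "a \<bullet> y \<le> b" "a \<bullet> z \<le> b" using y z ab by (auto simp: feasible_def in_tight)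
      have 2: "(1 - u) * (a \<bullet> y) + u * (a \<bullet> z) = b" using ab u by (auto simp: in_tight inner_add_right)
      have "(1-u) * (b - a \<bullet> y) + u * (b - a \<bullet> z) = 0" using 2 by (simp add: algebra_simps)
      moreover have "(1-u) * (b - a \<bullet> y) \<ge> 0" "u * (b - a \<bullet> z) \<ge> 0" using 1 u by auto
      ultimately have "(1-u) * (b - a \<bullet> y) = 0" by linarith
      then show ?thesis using u by auto
    qed
    then have "y = x" using R y by (auto simp: feasible_def)
    then have "u *\<^sub>R (z - y) = 0" using u(3) by (auto simp: algebra_simps)
    then show False using u ne by auto
  qed
  then show ?L using R by (auto simp: extreme_point_of_def)
qed

text \<open>
Each hyperplane through a common point lowers the dimension by at most one; as the tight constraints at a
vertex cut \<open>A\<close> down to a point, there must be at least \<open>aff_dim A\<close> of them.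
\<close>

lemma aff_dim_cut:
  assumes "affine A" "finite T" "x \<in> A" "\<And>a b. (a, b) \<in> T \<Longrightarrow> a \<bullet> x = b"
  shows "aff_dim A \<le> aff_dim {y \<in> A. \<forall>a b. (a, b) \<in> T \<longrightarrow> a \<bullet> y = b} + card T
    \<and> affine {y \<in> A. \<forall>a b. (a, b) \<in> T \<longrightarrow> a \<bullet> y = b}"
  using assms(2,4)
proof (induction T rule: finite_induct)
  case empty
  then show ?case using assms by simp
next
  case (insert p T)
  obtain a0 b0 where p: "p = (a0, b0)" by (cases p)
  let ?B = "{y \<in> A. \<forall>a b. (a, b) \<in> T \<longrightarrow> a \<bullet> y = b}"
  have eq: "{y \<in> A. \<forall>a b. (a, b) \<in> insert p T \<longrightarrow> a \<bullet> y = b} = ?B \<inter> {y. a0 \<bullet> y = b0}"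
    using p by auto
  have IH: "aff_dim A \<le> aff_dim ?B + card T" "affine ?B" using insert by auto
  have "x \<in> ?B \<inter> {y. a0 \<bullet> y = b0}" using insert.prems assms p by auto
  then have "aff_dim ?B \<le> aff_dim (?B \<inter> {y. a0 \<bullet> y = b0}) + 1"
    using aff_dim_affine_Int_hyperplane[OF IH(2), of a0 b0] by auto
  then show ?case unfolding eq using IH insert.hyps by (auto intro: affine_Int affine_hyperplane)
qed

lemma card_tight_ge:
  assumes "affine A" "finite I" "x extreme_point_of feasible A I"
  shows "aff_dim A \<le> card (tight I x)"
proof -
  have fin: "finite (tight I x)" using assms(2) tight_subset finite_subset by blast
  let ?B = "{y \<in> A. \<forall>a b. (a, b) \<in> tight I x \<longrightarrow> a \<bullet> y = b}"
  have x: "x \<in> A" using assms by (auto simp: extreme_point_of_def feasible_def)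
  have "?B = {x}" using assms(3) x unfolding extreme_point_feasible_iff[OF assms(1,2)] by (auto simp: in_tight)
  then have "aff_dim ?B = 0" by simp
  moreover have "aff_dim A \<le> aff_dim ?B + card (tight I x)"
    using aff_dim_cut[OF assms(1) fin x] by (auto simp: in_tight)
  ultimately show ?thesis by simp
qed

lemma facet_eq: "feasible (A \<inter> {x. a \<bullet> x = b}) I = feasible A I \<inter> {x. a \<bullet> x = b}"
  by (auto simp: feasible_def)

lemma facet_face_of:
  assumes "affine A" "finite I" "(a, b) \<in> I"
  shows "feasible (A \<inter> {x. a \<bullet> x = b}) I face_of feasible A I"
  unfolding facet_eq
  by (rule face_of_Int_supporting_hyperplane_le[OF convex_feasible]) (use assms in \<open>auto simp: feasible_def\<close>)

lemma edges_face:
  assumes "F face_of P"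
  shows "edges F \<subseteq> edges P"
proof -
  have "x extreme_point_of P" if "x extreme_point_of F" for x
    using that assms extreme_point_of_face by blast
  then show ?thesis using assms face_of_trans unfolding edges_def by blast
qed

lemma sym_edges: "(x, y) \<in> edges P \<longleftrightarrow> (y, x) \<in> edges P"
  by (auto simp: edges_def closed_segment_commute)

lemma relpow_edges_sym: "(x, y) \<in> edges P ^^ k \<Longrightarrow> (y, x) \<in> edges P ^^ k"
proof (induction k arbitrary: y)
  case (Suc k)
  then obtain z where "(x, z) \<in> edges P ^^ k" "(z, y) \<in> edges P" by auto
  then show ?case using Suc.IH sym_edges relpow_Suc_I2 by metis
qed auto

text \<open>
The ratio test of the simplex method: a ray that runs towards at least one of the
constraints first meets some constraint, with equality, before violating any.
\<close>

lemma cut_ray: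
  fixes x u :: "'a::euclidean_space"
  assumes "finite T" "\<And>a b. (a, b) \<in> T \<Longrightarrow> a \<bullet> x \<le> b" "(a0, b0) \<in> T" "a0 \<bullet> u > 0"
  obtains t a b where "t \<ge> 0" "(a, b) \<in> T" "a \<bullet> u > 0" "a \<bullet> (x + t *\<^sub>R u) = b"
    "\<And>a b. (a, b) \<in> T \<Longrightarrow> a \<bullet> (x + t *\<^sub>R u) \<le> b"
proof -
  define U where "U = {p \<in> T. fst p \<bullet> u > 0}"
  define f where "f = (\<lambda>p. (snd p - fst p \<bullet> x) / (fst p \<bullet> u))"
  have U: "finite U" "U \<noteq> {}" using assms by (auto simp: U_def)
  define t where "t = Min (f ` U)"
  obtain p where p: "p \<in> U" "t = f p" using U unfolding t_def by (metis (no_types, lifting) Min_in finite_imageI image_iff image_is_empty)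
  have t0: "t \<ge> 0" using p assms(2)[of "fst p" "snd p"] by (auto simp: U_def f_def)
  have le: "a \<bullet> (x + t *\<^sub>R u) \<le> b" if ab: "(a, b) \<in> T" for a b
  proof (cases "a \<bullet> u > 0")
    case True
    then have "t \<le> f (a, b)" unfolding t_def using U ab by (intro Min_le) (auto simp: U_def)
    then show ?thesis using True by (simp add: f_def field_simps inner_add_right)
  next
    case False
    then have "t * (a \<bullet> u) \<le> 0" using t0 by (simp add: mult_nonneg_nonpos)
    then show ?thesis using assms(2)[OF ab] by (simp add: inner_add_right)
  qed
  have "fst p \<bullet> (x + t *\<^sub>R u) = snd p" using p by (simp add: U_def f_def inner_add_right)
  then show ?thesis using that[of t "fst p" "snd p"] t0 le p by (auto simp: U_def)
qed

section \<open>Connectedness of the graph of a polyhedron\<close>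

text \<open>
This is what makes the simplex method move. A better point \<open>x\<close> is pushed along a direction in which
\<open>h\<close> is constant until it meets a constraint that is tight at \<open>r\<close>; this is possible as long as there are
two dimensions to move in, because no line through \<open>r\<close> satisfies all the constraints tight at \<open>r\<close>.
Shrinking towards \<open>r\<close> then yields a better point in a facet through \<open>r\<close>, and induction on the dimension
applies. In dimension one the polyhedron is a ray or a segment starting at \<open>r\<close>, and the lower bound \<open>c\<close>
rules out the ray.
\<close>

lemma improving_edge:
  fixes A :: "'a::euclidean_space set"
  assumes "aff_dim A = int d" "affine A" "finite I" "r extreme_point_of feasible A I"
    "x \<in> feasible A I" "h \<bullet> x < h \<bullet> r" "\<And>y. y \<in> feasible A I \<Longrightarrow> c \<le> h \<bullet> y"
  shows "\<exists>z. (r, z) \<in> edges (feasible A I) \<and> h \<bullet> z < h \<bullet> r"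
  using assms
proof (induction d arbitrary: A x rule: less_induct)
  case (less d)
  note A = less.prems(2) and I = less.prems(3)
  have rP: "r \<in> feasible A I" using less.prems by (simp add: extreme_point_of_def)
  have rA: "r \<in> A" and xA: "x \<in> A" using less.prems rP by (auto simp: feasible_def)
  have ne: "x \<noteq> r" using less.prems by auto
  have "aff_dim {r, x} \<le> aff_dim A" using rA xA by (intro aff_dim_subset) auto
  then have d1: "d \<ge> 1" using less.prems(1) ne by (simp add: aff_dim_2)
  show ?case
  proof (cases "d = 1")
    case True
    define u where "u = x - r"
    have hu: "h \<bullet> u < 0" using less.prems by (simp add: u_def inner_diff_right)
    have line: "\<exists>s. y = r + s *\<^sub>R u" if "y \<in> A" for y
    proof -
      have "affine hull {r, x} = A"
      proof (rule affine_dim_equal)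
        show "affine hull {r, x} \<subseteq> A" using rA xA A by (intro hull_minimal) auto
        show "aff_dim (affine hull {r, x}) = aff_dim A"
          using True ne less.prems(1) by (simp add: aff_dim_2)
      qed (use A in auto)
      then have "y \<in> affine hull {r, x}" using that by simp
      then show ?thesis by (auto simp: affine_hull_2_alt u_def)
    qed
    have inA: "r + s *\<^sub>R u \<in> A" for s using mem_affine_3_minus[OF A rA xA rA] by (simp add: u_def)
    \<comment> \<open>Otherwise the ray from \<open>r\<close> through \<open>x\<close> is feasible and \<open>h\<close> is unbounded below on it.\<close>
    have "\<exists>a0 b0. (a0, b0) \<in> I \<and> a0 \<bullet> u > 0"
    proof (rule ccontr)
      assume *: "\<not> ?thesis"
      have mem: "r + s *\<^sub>R u \<in> feasible A I" if "s \<ge> 0" for s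
      proof -
        have "a \<bullet> (r + s *\<^sub>R u) \<le> b" if ab: "(a, b) \<in> I" for a b
        proof -
          have "s * (a \<bullet> u) \<le> 0" using * ab \<open>s \<ge> 0\<close> by (intro mult_nonneg_nonpos) (auto simp: not_less)
          moreover have "a \<bullet> r \<le> b" using rP ab by (auto simp: feasible_def)
          ultimately show ?thesis by (simp add: inner_add_right)
        qed
        then show ?thesis using inA by (simp add: feasible_def)
      qed
      define s where "s = max 0 ((h \<bullet> r - c + 1) / - (h \<bullet> u))"
      have "s \<ge> (h \<bullet> r - c + 1) / - (h \<bullet> u)" by (simp add: s_def)
      then have "s * - (h \<bullet> u) \<ge> h \<bullet> r - c + 1" using hu by (subst (asm) pos_divide_le_eq) auto
      then have "h \<bullet> (r + s *\<^sub>R u) < c" by (simp add: inner_add_right)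
      moreover have "c \<le> h \<bullet> (r + s *\<^sub>R u)" by (rule less.prems(7)[OF mem]) (simp add: s_def)
      ultimately show False by simp
    qed
    then obtain a0 b0 where ab0: "(a0, b0) \<in> I" "a0 \<bullet> u > 0" by blast
    have xle: "a \<bullet> x \<le> b" if "(a, b) \<in> I" for a b using that less.prems(5) by (auto simp: feasible_def)
    \<comment> \<open>The ray is followed from \<open>x\<close> rather than from \<open>r\<close>, so that the end point \<open>z\<close> differs from \<open>r\<close>.\<close>
    obtain t a b where t: "t \<ge> 0" "(a, b) \<in> I" "a \<bullet> u > 0" "a \<bullet> (x + t *\<^sub>R u) = b"
      "\<And>a b. (a, b) \<in> I \<Longrightarrow> a \<bullet> (x + t *\<^sub>R u) \<le> b"
      using cut_ray[OF I xle ab0] by metis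
    define z where "z = x + t *\<^sub>R u"
    have z: "z = r + (t + 1) *\<^sub>R u" by (simp add: z_def u_def algebra_simps)
    have zP: "z \<in> feasible A I" using t(5) inA[of "t + 1"] unfolding z[symmetric] by (simp add: feasible_def z_def)
    have zr: "z \<noteq> r" using t(1) ne by (auto simp: z u_def)
    have seg: "feasible A I = closed_segment r z"
    proof
      show "closed_segment r z \<subseteq> feasible A I"
        using convex_feasible[OF A I] rP zP by (simp add: closed_segment_subset)
      show "feasible A I \<subseteq> closed_segment r z"
      proof
        fix y assume y: "y \<in> feasible A I"
        then obtain s where s: "y = r + s *\<^sub>R u" using line[of y] by (auto simp: feasible_def)
        have s0: "s \<ge> 0"
        proof (rule ccontr)
          assume "\<not> s \<ge> 0"
          then have "s < 0" by simp
          \<comment> \<open>The weight with which \<open>r\<close> would lie strictly between \<open>y\<close> and \<open>x\<close>.\<close>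
          define q where "q = - s / (1 - s)"
          have "0 < q" unfolding q_def by (rule divide_pos_pos) (use \<open>s < 0\<close> in auto)
          moreover have "q < 1" unfolding q_def by (subst pos_divide_less_eq) (use \<open>s < 0\<close> in auto)
          ultimately have q: "0 < q" "q < 1" by auto
          have "s * (1 - q) + q = 0" using \<open>s < 0\<close> by (simp add: q_def field_simps)
          then have "(s * (1 - q) + q) *\<^sub>R u = 0" by simp
          then have "r = (1 - q) *\<^sub>R y + q *\<^sub>R x"
            by (simp add: s u_def algebra_simps)
          moreover have "y \<noteq> x"
          proof -
            have "y - x = (s - 1) *\<^sub>R u" by (simp add: s u_def algebra_simps)
            moreover have "(s - 1) *\<^sub>R u \<noteq> 0" using \<open>s < 0\<close> ne by (simp add: u_def)
            ultimately show ?thesis by auto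
          qed
          ultimately have "r \<in> open_segment y x" using q by (auto simp: in_segment)
          then show False using less.prems(4,5) y by (auto simp: extreme_point_of_def)
        qed
        have "a \<bullet> y \<le> a \<bullet> z" using y t(2,4) by (auto simp: feasible_def z_def)
        then have "s * (a \<bullet> u) \<le> (t + 1) * (a \<bullet> u)" by (simp add: s z inner_add_right)
        then have "s \<le> t + 1" using t(3) by simp
        then show "y \<in> closed_segment r z" unfolding s z by (rule ray_in_segment[OF s0])
      qed
    qed
    have "(r, z) \<in> edges (feasible A I)"
      using zr by (simp add: edges_def seg extreme_point_of_segment face_of_refl)
    moreover have "h \<bullet> z < h \<bullet> r"
      using hu t(1) by (simp add: z inner_add_right mult_pos_neg)
    ultimately show ?thesis by blast
  next
    case False
    then have d2: "d \<ge> 2" using d1 by simp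
    \<comment> \<open>A level set of \<open>h\<close> still has positive dimension, which provides the direction of the push.\<close>
    let ?B = "A \<inter> {y. h \<bullet> y = h \<bullet> x}"
    have "aff_dim ?B \<ge> int d - 1"
      using aff_dim_affine_Int_hyperplane[OF A, of h "h \<bullet> x"] xA less.prems(1) by auto
    then have "?B \<noteq> {x}" using d2 by auto
    then obtain y where y: "y \<in> A" "h \<bullet> y = h \<bullet> x" "y \<noteq> x" using xA by auto
    have "\<exists>u. u \<noteq> 0 \<and> h \<bullet> u = 0 \<and> (\<forall>s. x + s *\<^sub>R u \<in> A) \<and> (\<forall>s. r + s *\<^sub>R u \<in> A)
        \<and> (\<exists>a b. (a, b) \<in> tight I r \<and> a \<bullet> u > 0)"
    proof -
      let ?u = "y - x"
      have mv: "p + s *\<^sub>R ?u \<in> A" if "p \<in> A" for p s using mem_affine_3_minus[OF A that y(1) xA] .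
      have "r + ?u \<in> A" "r + ?u \<noteq> r" using mv[OF rA, of 1] y by auto
      then obtain a b where ab: "(a, b) \<in> tight I r" "a \<bullet> (r + ?u) \<noteq> b"
        using less.prems(4) unfolding extreme_point_feasible_iff[OF A I] by blast
      then have "a \<bullet> ?u \<noteq> 0" by (auto simp: in_tight inner_add_right)
      then consider "a \<bullet> ?u > 0" | "a \<bullet> (- ?u) > 0" by (fastforce simp: inner_diff_right)
      then show ?thesis
      proof cases
        case 1
        then show ?thesis using ab mv xA rA y by (intro exI[of _ ?u]) (auto simp: inner_diff_right)
      next
        case 2
        have "p + s *\<^sub>R (- ?u) \<in> A" if "p \<in> A" for p s using mv[OF that, of "-s"] by (simp add: algebra_simps)
        then show ?thesis using 2 ab xA rA y by (intro exI[of _ "- ?u"]) (auto simp: inner_diff_right)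
      qed
    qed
    then obtain u a0 b0 where u: "u \<noteq> 0" "h \<bullet> u = 0" "\<And>s. x + s *\<^sub>R u \<in> A" "\<And>s. r + s *\<^sub>R u \<in> A"
      "(a0, b0) \<in> tight I r" "a0 \<bullet> u > 0" by blast
    have fin: "finite (tight I r)" using I tight_subset finite_subset by blast
    have xle: "a \<bullet> x \<le> b" if "(a, b) \<in> tight I r" for a b
      using that less.prems(5) by (auto simp: feasible_def in_tight)
    obtain t a b where t: "t \<ge> 0" "(a, b) \<in> tight I r" "a \<bullet> u > 0" "a \<bullet> (x + t *\<^sub>R u) = b"
      "\<And>a b. (a, b) \<in> tight I r \<Longrightarrow> a \<bullet> (x + t *\<^sub>R u) \<le> b"
      using cut_ray[OF fin xle u(5,6)] by metis
    \<comment> \<open>The pushed point may violate constraints that are slack at \<open>r\<close>; a small step from \<open>r\<close> towards it does not.\<close>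
    define w where "w = x + t *\<^sub>R u - r"
    have slack: "a \<bullet> r < b" if "(a, b) \<in> I - tight I r" for a b
      using that rP by (simp add: feasible_def in_tight less_le)
    obtain e where e: "e > 0"
      "\<And>a b s. (a, b) \<in> I - tight I r \<Longrightarrow> \<bar>s\<bar> \<le> e \<Longrightarrow> a \<bullet> (r + s *\<^sub>R w) \<le> b"
      using slack_move[OF finite_Diff[OF I] slack, of "tight I r" w] by metis
    define x' where "x' = r + e *\<^sub>R w"
    have x'P: "x' \<in> feasible A I"
    proof -
      have "a \<bullet> x' \<le> b" if ab: "(a, b) \<in> I" for a b
      proof (cases "(a, b) \<in> tight I r")
        case True
        then have "a \<bullet> w \<le> 0" using t(5)[of a b] by (simp add: w_def in_tight inner_diff_right)
        then have "e * (a \<bullet> w) \<le> 0" using e by (simp add: mult_nonneg_nonpos)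
        then show ?thesis using True by (simp add: x'_def in_tight inner_add_right)
      next
        case False
        then show ?thesis using e(2)[of a b e] e ab by (simp add: x'_def)
      qed
      moreover have "x' \<in> A" unfolding x'_def w_def by (rule mem_affine_3_minus[OF A rA u(3) rA])
      ultimately show ?thesis by (simp add: feasible_def)
    qed
    let ?A = "A \<inter> {y. a \<bullet> y = b}"
    have ar: "a \<bullet> r = b" and abI: "(a, b) \<in> I" using t(2) by (auto simp: in_tight)
    have "r + 1 *\<^sub>R u \<notin> {y. a \<bullet> y = b}" using t(3) ar by (simp add: inner_add_right)
    then have dimA: "aff_dim ?A = int (d - 1)"
      using aff_dim_affine_Int_hyperplane[OF A, of a b] u(4)[of 1] rA ar less.prems(1) d1
      by (auto simp: of_nat_diff)
    have face: "feasible ?A I face_of feasible A I" by (rule facet_face_of[OF A I abI])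
    have aw: "a \<bullet> w = 0" using t(4) ar by (simp add: w_def inner_diff_right)
    have hw: "h \<bullet> w = h \<bullet> x - h \<bullet> r" using u(2) by (simp add: w_def inner_add_right inner_diff_right)
    have "\<exists>z. (r, z) \<in> edges (feasible ?A I) \<and> h \<bullet> z < h \<bullet> r"
    proof (rule less.IH)
      show "d - 1 < d" using d1 by simp
      show "aff_dim ?A = int (d - 1)" by (rule dimA)
      show "affine ?A" using A by (intro affine_Int affine_hyperplane)
      show "finite I" by fact
      show "r extreme_point_of feasible ?A I"
        using face less.prems(4) rP ar by (simp add: extreme_point_of_face facet_eq)
      show "x' \<in> feasible ?A I" using x'P ar aw by (simp add: facet_eq x'_def inner_add_right)
      show "h \<bullet> x' < h \<bullet> r" using e less.prems(6)
        by (simp add: x'_def inner_add_right hw mult_pos_neg)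
      show "c \<le> h \<bullet> y" if "y \<in> feasible ?A I" for y using that less.prems(7) by (simp add: facet_eq)
    qed
    then show ?thesis using edges_face[OF face] by blast
  qed
qed

text \<open>
Some linear function has \<open>w\<close> as its unique minimizer. Among the finitely many vertices
reachable from \<open>v\<close>, the one with the least value can only be \<open>w\<close>, since any other one has an
improving edge.
\<close>

lemma extreme_points_connected:
  assumes A: "affine A" and I: "finite I"
    and v: "v extreme_point_of feasible A I" and w: "w extreme_point_of feasible A I"
  shows "(v, w) \<in> (edges (feasible A I))\<^sup>*"
proof -
  let ?P = "feasible A I"
  have "{w} exposed_face_of ?P"
    using exposed_face_of_polyhedron[OF polyhedron_feasible[OF A I]] w face_of_singleton by blast
  then obtain g b where g: "?P \<subseteq> {x. g \<bullet> x \<le> b}" "{w} = ?P \<inter> {x. g \<bullet> x = b}"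
    by (auto simp: exposed_face_of_def)
  define h where "h = - g"
  have low: "- b \<le> h \<bullet> y" if "y \<in> ?P" for y using g that by (auto simp: h_def)
  have uniq: "h \<bullet> w < h \<bullet> y" if "y \<in> ?P" "y \<noteq> w" for y
  proof -
    have "g \<bullet> y \<le> b" "g \<bullet> y \<noteq> b" "g \<bullet> w = b" using g that by auto
    then show ?thesis by (simp add: h_def)
  qed
  define R where "R = {y. (v, y) \<in> (edges ?P)\<^sup>*}"
  have ext: "y extreme_point_of ?P" if "y \<in> R" for y
  proof -
    have "(v, y) \<in> (edges ?P)\<^sup>*" using that by (simp add: R_def)
    then show ?thesis using v by (cases rule: rtranclE) (auto simp: edges_def)
  qed
  have "finite R"
    by (rule finite_subset[OF _ finite_polyhedron_extreme_points[OF polyhedron_feasible[OF A I]]])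
      (use ext in blast)
  moreover have "v \<in> R" by (simp add: R_def)
  ultimately obtain r where r: "r \<in> R" "\<And>y. y \<in> R \<Longrightarrow> h \<bullet> r \<le> h \<bullet> y"
    using arg_min_if_finite(1)[of R "\<lambda>y. h \<bullet> y"] arg_min_least[of R _ "\<lambda>y. h \<bullet> y"] by blast
  have "r = w"
  proof (rule ccontr)
    assume "r \<noteq> w"
    have rP: "r \<in> ?P" and wP: "w \<in> ?P" using ext[OF r(1)] w by (auto simp: extreme_point_of_def)
    have "A \<noteq> {}" using rP by (auto simp: feasible_def)
    then have "aff_dim A = int (nat (aff_dim A))"
      using aff_dim_negative_iff[of A] by linarith
    from improving_edge[OF this A I ext[OF r(1)] wP uniq[OF rP \<open>r \<noteq> w\<close>] low]
    obtain z where z: "(r, z) \<in> edges ?P" "h \<bullet> z < h \<bullet> r" by blast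
    have "z \<in> R" using r(1) z(1) unfolding R_def by (auto intro: rtrancl_into_rtrancl)
    then show False using r(2) z(2) by fastforce
  qed
  then show ?thesis using r by (simp add: R_def)
qed

section \<open>Dropping distant constraints\<close>

lemma extreme_point_relax:
  assumes "affine A" "finite I" "V \<subseteq> I" "x extreme_point_of feasible A I" "tight I x \<subseteq> V"
  shows "x extreme_point_of feasible A V"
proof -
  have V: "finite V" using assms finite_subset by blast
  have "tight V x = tight I x" using assms by (auto simp: tight_def)
  then show ?thesis
    using assms unfolding extreme_point_feasible_iff[OF assms(1,2)] extreme_point_feasible_iff[OF assms(1) V]
    by (auto simp: feasible_def)
qed

text \<open>
Dropping constraints that are slack at a vertex \<open>x\<close> does not change the polyhedron near \<open>x\<close>. An edge of
the larger polyhedron at \<open>x\<close> is therefore either an edge of the smaller one or is cut off by a dropped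
constraint, and in the latter case the shortened edge ends in a vertex where a dropped constraint is tight.
\<close>

lemma edge_relaxation:
  assumes A: "affine A" and I: "finite I" and VI: "V \<subseteq> I"
    and xy: "(x, y) \<in> edges (feasible A V)" and xP: "x \<in> feasible A I" and tight: "tight I x \<subseteq> V"
  shows "\<exists>z. (x, z) \<in> edges (feasible A I) \<and> (z = y \<or> \<not> tight I z \<subseteq> V)"
proof -
  let ?P = "feasible A I" and ?Q = "feasible A V"
  have sub: "?P \<subseteq> ?Q" using VI by (auto simp: feasible_def)
  have x: "x extreme_point_of ?Q" and y: "y extreme_point_of ?Q" and ne: "x \<noteq> y"
    and face: "closed_segment x y face_of ?Q" using xy by (auto simp: edges_def)
  have yA: "y \<in> A" and xA: "x \<in> A" using x y by (auto simp: extreme_point_of_def feasible_def)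
  define u where "u = y - x"
  \<comment> \<open>The extra inequality, tight exactly where the ray reaches \<open>y\<close>, stops it there if no dropped constraint does.\<close>
  define J where "J = insert (u, u \<bullet> y) (I - V)"
  have finJ: "finite J" using I by (simp add: J_def)
  have xle: "a \<bullet> x \<le> b" if ab: "(a, b) \<in> J" for a b
  proof (cases "(a, b) \<in> I")
    case True
    then show ?thesis using xP by (auto simp: feasible_def)
  next
    case False
    then have "a = u" "b = u \<bullet> y" using ab by (auto simp: J_def)
    moreover have "u \<bullet> y - u \<bullet> x = u \<bullet> u" by (simp add: u_def inner_diff_right)
    then have "u \<bullet> x \<le> u \<bullet> y" using inner_ge_zero[of u] by linarith
    ultimately show ?thesis by simp
  qed
  have J0: "(u, u \<bullet> y) \<in> J" "u \<bullet> u > 0" using ne by (auto simp: J_def u_def)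
  obtain t a b where t: "t \<ge> 0" "(a, b) \<in> J" "a \<bullet> u > 0" "a \<bullet> (x + t *\<^sub>R u) = b"
    "\<And>a b. (a, b) \<in> J \<Longrightarrow> a \<bullet> (x + t *\<^sub>R u) \<le> b"
    using cut_ray[OF finJ xle J0] by metis
  define z where "z = x + t *\<^sub>R u"
  have "u \<bullet> (x + t *\<^sub>R u) \<le> u \<bullet> (x + u)" using t(5)[OF J0(1)] by (simp add: u_def)
  then have "t * (u \<bullet> u) \<le> 1 * (u \<bullet> u)" by (simp add: inner_add_right)
  then have t1: "t \<le> 1" using J0(2) mult_le_cancel_right_pos by blast
  have z_conv: "z = (1 - t) *\<^sub>R x + t *\<^sub>R y" by (simp add: z_def u_def algebra_simps)
  have zseg: "z \<in> closed_segment x y" using z_conv t(1) t1 by (auto simp: in_segment)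
  have zQ: "z \<in> ?Q" using zseg face face_of_imp_subset by blast
  have zP: "z \<in> ?P"
  proof -
    have "a \<bullet> z \<le> b" if "(a, b) \<in> I" for a b
    proof (cases "(a, b) \<in> V")
      case True
      then show ?thesis using zQ by (simp add: feasible_def)
    next
      case False
      then show ?thesis using that t(5)[of a b] unfolding J_def z_def by blast
    qed
    then show ?thesis using zQ by (simp add: feasible_def)
  qed
  have t0: "t \<noteq> 0"
  proof
    assume "t = 0"
    then have ab: "a \<bullet> x = b" using t(4) by simp
    show False
    proof (cases "(a, b) \<in> I - V")
      case True
      then have "(a, b) \<in> tight I x" using ab by (simp add: in_tight)
      then show False using tight True by blast
    next
      case False
      then have "a = u" "b = u \<bullet> y" using t(2) by (auto simp: J_def)
      then have "u \<bullet> u = 0" using ab by (simp add: u_def inner_diff_right)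
      then show False using J0 by simp
    qed
  qed
  have zx: "z \<noteq> x" using t0 J0 by (auto simp: z_def)
  have end_case: "z = y \<or> (a, b) \<in> tight I z - V"
  proof (cases "(a, b) \<in> I - V")
    case True
    then show ?thesis using t(4) by (auto simp: in_tight z_def)
  next
    case False
    then have "a = u" "b = u \<bullet> y" using t(2) by (auto simp: J_def)
    then have "u \<bullet> (x + t *\<^sub>R u) = u \<bullet> (x + u)" using t(4) by (simp add: u_def)
    then have "t = 1" using J0 by (simp add: inner_add_right)
    then show ?thesis by (simp add: z_def u_def)
  qed
  have cut: "closed_segment x y \<inter> ?P = closed_segment x z"
  proof
    show "closed_segment x z \<subseteq> closed_segment x y \<inter> ?P"
      using zseg zP xP convex_feasible[OF A I] by (simp add: closed_segment_subset)
    show "closed_segment x y \<inter> ?P \<subseteq> closed_segment x z"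
    proof
      fix q assume q: "q \<in> closed_segment x y \<inter> ?P"
      then obtain s where s: "0 \<le> s" "s \<le> 1" "q = (1 - s) *\<^sub>R x + s *\<^sub>R y" by (auto simp: in_segment)
      then have qs: "q = x + s *\<^sub>R u" by (simp add: u_def algebra_simps)
      have "s \<le> t"
      proof (cases "z = y")
        case True
        then have "(t - 1) *\<^sub>R u = 0" by (simp add: z_def u_def algebra_simps)
        then show ?thesis using J0 s by auto
      next
        case False
        then have "(a, b) \<in> I" using end_case by (auto simp: in_tight)
        then have "a \<bullet> q \<le> b" using q by (auto simp: feasible_def)
        then have "s * (a \<bullet> u) \<le> t * (a \<bullet> u)" using t(4) by (simp add: qs inner_add_right)
        then show ?thesis using t(3) by simp
      qed
      then show "q \<in> closed_segment x z" unfolding qs z_def by (rule ray_in_segment[OF s(1)])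
    qed
  qed
  have faceP: "closed_segment x z face_of ?P"
    using face_of_slice[OF face convex_feasible[OF A I]] sub unfolding cut by (simp add: Int_absorb1)
  have "x extreme_point_of ?P" "z extreme_point_of ?P"
    using extreme_point_of_face[OF faceP] by (auto simp: extreme_point_of_segment)
  then have "(x, z) \<in> edges ?P" using faceP zx by (auto simp: edges_def)
  then show ?thesis using end_case by blast
qed

definition tight_near :: "'a::euclidean_space set \<Rightarrow> ('a \<times> real) set \<Rightarrow> 'a \<Rightarrow> nat \<Rightarrow> ('a \<times> real) set" where
  "tight_near A I v k = (\<Union>j\<le>k. \<Union>x\<in>{x. (v, x) \<in> edges (feasible A I) ^^ j}. tight I x)"

lemma tight_near_subset: "tight_near A I v k \<subseteq> I"
  using tight_subset by (auto simp: tight_near_def)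

lemma tight_near_I: "(v, x) \<in> edges (feasible A I) ^^ j \<Longrightarrow> j \<le> k \<Longrightarrow> tight I x \<subseteq> tight_near A I v k"
  unfolding tight_near_def by blast

lemma relpow_edges_extreme:
  "(v, x) \<in> edges P ^^ j \<Longrightarrow> v extreme_point_of P \<Longrightarrow> x extreme_point_of P"
  by (cases j) (auto simp: edges_def)

text \<open>
A path of length at most \<open>k\<close> from \<open>v\<close> in the polyhedron of the nearby constraints never leaves the
original polyhedron: the first edge doing so would be cut off by a far constraint, which would then be
tight at distance at most \<open>k\<close>.
\<close>

lemma short_path_relaxation:
  assumes "affine A" "finite I" "v extreme_point_of feasible A I"
    and "(v, y) \<in> edges (feasible A (tight_near A I v k)) ^^ j" "j \<le> k"
  shows "(v, y) \<in> edges (feasible A I) ^^ j"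
  using assms(4,5)
proof (induction j arbitrary: y)
  case (Suc j)
  let ?V = "tight_near A I v k"
  obtain x where x: "(v, x) \<in> edges (feasible A ?V) ^^ j" "(x, y) \<in> edges (feasible A ?V)"
    using Suc.prems by auto
  then have vx: "(v, x) \<in> edges (feasible A I) ^^ j" using Suc by auto
  have xP: "x \<in> feasible A I"
    using relpow_edges_extreme[OF vx assms(3)] by (simp add: extreme_point_of_def)
  have "tight I x \<subseteq> ?V" using vx Suc.prems by (intro tight_near_I[where j = j]) auto
  from edge_relaxation[OF assms(1,2) tight_near_subset x(2) xP this]
  obtain z where z: "(x, z) \<in> edges (feasible A I)" "z = y \<or> \<not> tight I z \<subseteq> ?V" by blast
  have "(v, z) \<in> edges (feasible A I) ^^ Suc j" using vx z by auto
  moreover from this have "tight I z \<subseteq> ?V" using Suc.prems by (intro tight_near_I)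
  ultimately show ?case using z by blast
qed auto

text \<open>
Having \<open>card I \<le> n\<close> instead of equality makes the bound usable for every smaller system.
Constraints that are equations on all of \<open>A\<close> are excluded, because the hyperplane of such a
constraint does not cut \<open>A\<close> down to a subspace of smaller dimension.
\<close>

definition diam_le :: "'a::euclidean_space itself \<Rightarrow> nat \<Rightarrow> nat \<Rightarrow> real \<Rightarrow> bool" where
  "diam_le _ d n B \<longleftrightarrow> (\<forall>(A :: 'a set) I v w. affine A \<and> aff_dim A = int d \<and> finite I \<and> card I \<le> n \<and>
     (\<forall>a b. (a, b) \<in> I \<longrightarrow> \<not> A \<subseteq> {x. a \<bullet> x = b}) \<and>
     v extreme_point_of feasible A I \<and> w extreme_point_of feasible A I \<longrightarrow>
     (\<exists>k. real k \<le> B \<and> (v, w) \<in> edges (feasible A I) ^^ k))"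

lemma diam_leD:
  assumes "diam_le TYPE('a::euclidean_space) d n B" "affine (A :: 'a set)" "aff_dim A = int d"
    "finite I" "card I \<le> n" "\<And>a b. (a, b) \<in> I \<Longrightarrow> \<not> A \<subseteq> {x. a \<bullet> x = b}"
    "v extreme_point_of feasible A I" "w extreme_point_of feasible A I"
  obtains k where "real k \<le> B" "(v, w) \<in> edges (feasible A I) ^^ k"
proof -
  have "\<exists>k. real k \<le> B \<and> (v, w) \<in> edges (feasible A I) ^^ k"
    using assms(1)[unfolded diam_le_def, rule_format, of A I v w] assms(2-8) by simp
  then show ?thesis using that by blast
qed

text \<open>
A shortest path from \<open>v\<close> to \<open>y\<close> remains shortest when only the constraints near \<open>v\<close> are kept, so its
length is bounded by the diameter of a polyhedron with few constraints.
\<close>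

lemma distance_le_relaxed_diameter:
  fixes A :: "'a::euclidean_space set"
  assumes A: "affine A" "aff_dim A = int d" and I: "finite I"
    "\<And>a b. (a, b) \<in> I \<Longrightarrow> \<not> A \<subseteq> {x. a \<bullet> x = b}"
    and v: "v extreme_point_of feasible A I"
    and y: "(v, y) \<in> edges (feasible A I) ^^ k" "\<And>j. (v, y) \<in> edges (feasible A I) ^^ j \<Longrightarrow> k \<le> j"
    and m: "card (tight_near A I v k) \<le> m" and diam: "diam_le TYPE('a) d m B"
  shows "real k \<le> B"
proof -
  let ?V = "tight_near A I v k"
  have V: "finite ?V" by (rule finite_subset[OF tight_near_subset I(1)])
  have "tight I v \<subseteq> ?V" by (rule tight_near_I[where j = 0]) auto
  then have v': "v extreme_point_of feasible A ?V"
    by (rule extreme_point_relax[OF A(1) I(1) tight_near_subset v])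
  have "tight I y \<subseteq> ?V" by (rule tight_near_I[OF y(1)]) auto
  then have y': "y extreme_point_of feasible A ?V"
    by (rule extreme_point_relax[OF A(1) I(1) tight_near_subset relpow_edges_extreme[OF y(1) v]])
  have "\<not> A \<subseteq> {x. a \<bullet> x = b}" if "(a, b) \<in> ?V" for a b
    using I(2) subsetD[OF tight_near_subset that] by blast
  from diam_leD[OF diam A V m this v' y']
  obtain j where j: "real j \<le> B" "(v, y) \<in> edges (feasible A ?V) ^^ j" by blast
  have "k \<le> j"
  proof (rule ccontr)
    assume "\<not> k \<le> j"
    then have "(v, y) \<in> edges (feasible A I) ^^ j"
      using short_path_relaxation[OF A(1) I(1) v j(2)] by simp
    from y(2)[OF this] show False using \<open>\<not> k \<le> j\<close> by simp
  qed
  then show ?thesis using j by simp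
qed

text \<open>
Since every vertex has at least \<open>d\<close> tight constraints, \<open>m < d\<close> gives \<open>k = 0\<close>: more than \<open>m\<close> constraints are
already tight at \<open>v\<close>. For \<open>d \<le> m\<close>, the last distance at which at most \<open>m\<close> constraints have been met is at
most \<open>B\<close>, and one further step meets more than \<open>m\<close>. The first alternative covers the case that \<open>w\<close> is
reached before that happens.
\<close>

lemma many_constraints_near:
  fixes A :: "'a::euclidean_space set"
  assumes A: "affine A" "aff_dim A = int d" and I: "finite I"
    "\<And>a b. (a, b) \<in> I \<Longrightarrow> \<not> A \<subseteq> {x. a \<bullet> x = b}"
    and v: "v extreme_point_of feasible A I"
    and w: "(v, w) \<in> edges (feasible A I) ^^ D" "\<And>j. (v, w) \<in> edges (feasible A I) ^^ j \<Longrightarrow> D \<le> j"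
    and diam: "d \<le> m \<Longrightarrow> diam_le TYPE('a) d m B" and B: "0 \<le> B"
  shows "d \<le> m \<and> real D \<le> B \<or>
    (\<exists>k. m < card (tight_near A I v k) \<and> real k \<le> (if d \<le> m then B + 1 else 0))"
proof -
  have near0: "card (tight I v) \<le> card (tight_near A I v k)" for k
  proof (rule card_mono)
    show "finite (tight_near A I v k)" using finite_subset[OF tight_near_subset I(1)] .
    show "tight I v \<subseteq> tight_near A I v k" by (rule tight_near_I[where j = 0]) auto
  qed
  have dm: "d \<le> m" if "card (tight_near A I v k) \<le> m" for k
    using card_tight_ge[OF A(1) I(1) v] A(2) near0[of k] that by linarith
  have key: "real k \<le> B" if k: "k \<le> D" "card (tight_near A I v k) \<le> m" for k
  proof -
    have "(v, w) \<in> edges (feasible A I) ^^ (k + (D - k))" using w(1) k by simp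
    then obtain y where y: "(v, y) \<in> edges (feasible A I) ^^ k" "(y, w) \<in> edges (feasible A I) ^^ (D - k)"
      unfolding relpow_add by blast
    have "k \<le> j" if "(v, y) \<in> edges (feasible A I) ^^ j" for j
      using w(2)[OF relpow_trans[OF that y(2)]] k by simp
    from distance_le_relaxed_diameter[OF A I v y(1) this k(2) diam[OF dm[OF k(2)]]]
    show ?thesis .
  qed
  show ?thesis
  proof (cases "\<exists>k\<le>D. m < card (tight_near A I v k)")
    case False
    then have "card (tight_near A I v D) \<le> m" by (simp add: not_less)
    then show ?thesis using key[of D] dm[of D] by simp
  next
    case True
    define K where "K = (LEAST k. m < card (tight_near A I v k))"
    have K: "m < card (tight_near A I v K)" "K \<le> D"
    proof -
      obtain k where k: "k \<le> D" "m < card (tight_near A I v k)" using True by blast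
      show "m < card (tight_near A I v K)" unfolding K_def by (rule LeastI) (rule k(2))
      have "K \<le> k" unfolding K_def by (rule Least_le) (rule k(2))
      then show "K \<le> D" using k(1) by simp
    qed
    have "real K \<le> (if d \<le> m then B + 1 else 0)"
    proof (cases K)
      case 0
      then show ?thesis using B by simp
    next
      case (Suc j)
      then have "card (tight_near A I v j) \<le> m"
        using not_less_Least[of j "\<lambda>k. m < card (tight_near A I v k)"] by (simp add: K_def not_less)
      then show ?thesis using key[of j] dm[of j] K Suc by simp
    qed
    then show ?thesis using K(1) by blast
  qed
qed

section \<open>The numerical recurrence\<close>

definition todd_bound :: "nat \<Rightarrow> nat \<Rightarrow> real" where
  "todd_bound d n = (real n - real d) powr log 2 (real d)"

lemma todd_bound_nonneg: "0 \<le> todd_bound d n"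
  by (simp add: todd_bound_def)

lemma todd_bound_mono:
  assumes "1 \<le> d" "d \<le> m" "m \<le> n"
  shows "todd_bound d m \<le> todd_bound d n"
  unfolding todd_bound_def using assms by (intro powr_mono2) auto

text \<open>
Put \<open>L = log 2 d\<close> and \<open>M = N powr (L - 1)\<close>. As \<open>2 powr L = d\<close>, halving divides the power by \<open>d\<close>, so
the second summand is at most \<open>2 + 2 * (N - d) * M / d\<close>, and the first is
\<open>N * M * c powr log 2 N\<close> with \<open>c = 1 - 1 / d\<close>. It remains to see that this is at most
\<open>N * M * (1 - 2 / d) + 2 * M - 2\<close>. For \<open>N \<ge> 8\<close> this holds because \<open>c ^ 3 \<le> 1 - 2 / d\<close>; for \<open>d \<ge> 4\<close> and
\<open>N < 8\<close> the excess of \<open>c ^ 2\<close> over \<open>1 - 2 / d\<close> is absorbed by \<open>2 * M - 2\<close>; for \<open>d = 3\<close> the first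
summand is just \<open>N\<close>. The values of \<open>N\<close> between \<open>3\<close> and \<open>4\<close> are excluded for \<open>d < 4\<close>
because the crude bounds on \<open>M\<close> do not suffice there; in the application \<open>d\<close> and \<open>N\<close> are integers.
\<close>

lemma power_estimate:
  fixes N d :: real
  assumes d: "3 \<le> d" and N: "d \<le> N" and small: "d < 4 \<Longrightarrow> d = 3 \<and> (N = 3 \<or> 4 \<le> N)"
  shows "N powr log 2 (d - 1) + 2 * (1 + ((N - d) / 2) powr log 2 d) \<le> N powr log 2 d"
proof -
  define L where "L = log 2 d"
  define M where "M = N powr (L - 1)"
  define c where "c = 1 - 1 / d"
  have N0: "N > 0" "N \<ge> 3" using d N by auto
  have L1: "L \<ge> 3 / 2"
  proof -
    have "(2::real) powr (3 / 2) = sqrt 8"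
      using powr_powr[of "2::real" 3 "1/2"] by (simp add: powr_half_sqrt powr_numeral)
    also have "\<dots> \<le> 3" by (rule real_le_lsqrt) auto
    finally have "2 powr (3 / 2) \<le> d" using d by simp
    moreover have "1 < (2::real)" "0 < d" using d by simp_all
    ultimately show ?thesis unfolding L_def by (metis le_log_iff)
  qed
  have twoL: "2 powr L = d" using d by (simp add: L_def)
  have NL: "N powr L = N * M"
    using powr_add[of N 1 "L - 1"] N0 by (simp add: M_def)
  have "(N - d) powr L \<le> (N - d) * M"
  proof (cases "N = d")
    case False
    then have pos: "N - d > 0" using N by simp
    then have "(N - d) powr L = (N - d) * (N - d) powr (L - 1)"
      using powr_add[of "N - d" 1 "L - 1"] by simp
    also have "(N - d) powr (L - 1) \<le> M"
      unfolding M_def using pos d L1 by (intro powr_mono2) auto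
    finally show ?thesis using pos by simp
  qed simp
  then have half: "((N - d) / 2) powr L \<le> (N - d) * M / d"
    using N d by (simp add: powr_divide twoL divide_right_mono)
  have M1: "M \<ge> 1" unfolding M_def using N0 L1 by (intro ge_one_powr_ge_zero) auto
  have c: "0 < c" "c < 1" using d by (auto simp: c_def)
  have first: "N powr log 2 (d - 1) = N * M * c powr log 2 N"
  proof -
    have "d - 1 = d * c" using d by (simp add: c_def algebra_simps)
    then have "log 2 (d - 1) = L + log 2 c" using d c by (simp add: L_def log_mult)
    then have "N powr log 2 (d - 1) = N * M * N powr log 2 c" by (simp add: powr_add NL)
    also have "N powr log 2 c = c powr log 2 N" using N0 c by (simp add: powr_def log_def)
    finally show ?thesis .
  qed
  have "N powr log 2 (d - 1) \<le> N * M * (1 - 2 / d) + 2 * M - 2"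
  proof -
    consider "8 \<le> N" | "4 \<le> d" "N < 8" | "d = 3" "N < 8" using small by (meson not_le)
    then show ?thesis
    proof cases
      case 1
      have "c powr log 2 N \<le> c powr 3"
        using c 1 N0 by (intro powr_mono') (auto simp: le_log_iff powr_numeral)
      also have "\<dots> = c ^ 3" using c by (simp add: powr_numeral)
      also have "\<dots> \<le> 1 - 2 / d"
      proof -
        have "1 - 2 / d - c ^ 3 = (1 / d) * (1 - 3 / d + 1 / d ^ 2)"
          using d by (simp add: c_def field_simps power3_eq_cube power2_eq_square)
        moreover have "1 - 3 / d \<ge> 0" using d by simp
        then have "1 - 3 / d + 1 / d ^ 2 \<ge> 0" by (simp add: add_nonneg_nonneg)
        then have "(1 / d) * (1 - 3 / d + 1 / d ^ 2) \<ge> 0" using d by (intro mult_nonneg_nonneg) auto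
        ultimately show ?thesis by linarith
      qed
      finally have "N * M * c powr log 2 N \<le> N * M * (1 - 2 / d)"
        using N0 M1 by (intro mult_left_mono) auto
      then show ?thesis using M1 first by linarith
    next
      case 2
      have N4: "4 \<le> N" using 2 N by simp
      have "c powr log 2 N \<le> c powr 2"
        using c N4 by (intro powr_mono') (auto simp: le_log_iff powr_numeral)
      also have "\<dots> = c ^ 2" using c by (simp add: powr_numeral)
      also have "\<dots> = 1 - 2 / d + 1 / d ^ 2"
        using d by (simp add: c_def field_simps power2_eq_square)
      finally have "N * M * c powr log 2 N \<le> N * M * (1 - 2 / d + 1 / d ^ 2)"
        using N0 M1 by (intro mult_left_mono) auto
      also have "\<dots> = N * M * (1 - 2 / d) + N * M * (1 / d ^ 2)" by (simp add: algebra_simps)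
      also have "N * M * (1 / d ^ 2) \<le> 8 * M * (1 / 16)"
      proof (intro mult_mono)
        have "4 ^ 2 \<le> d ^ 2" using 2 by (intro power_mono) auto
        then show "1 / d ^ 2 \<le> 1 / 16" by (intro divide_left_mono) auto
      qed (use 2 N0 M1 in auto)
      also have "8 * M * (1 / 16) \<le> 2 * M - 2"
      proof -
        have L2: "L \<ge> 2" using 2 by (simp add: L_def le_log_iff)
        have "4 powr 1 \<le> (4::real) powr (L - 1)" using L2 by (intro powr_mono) auto
        also have "\<dots> \<le> M" unfolding M_def using N4 L2 by (intro powr_mono2) auto
        finally show ?thesis by simp
      qed
      finally show ?thesis using first by linarith
    next
      case 3
      have lhs: "N powr log 2 (d - 1) = N" using 3 N0 by simp
      have "d < 4" using 3 by simp
      then consider "N = 3" | "4 \<le> N" using small by blast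
      then have "N \<le> N * M / 3 + 2 * M - 2"
      proof cases
        case 1
        have "5 / 3 \<le> sqrt 3" by (rule real_le_rsqrt) (simp add: power2_eq_square)
        also have "\<dots> = 3 powr (1 / 2)" by (simp add: powr_half_sqrt)
        also have "\<dots> \<le> M" unfolding M_def 1 using L1 by (intro powr_mono) auto
        finally show ?thesis using 1 by simp
      next
        case 2
        have "(4::real) powr L = 2 powr L * 2 powr L"
          using powr_mult[of "2::real" 2 L] by simp
        then have "9 / 4 = (4::real) powr (L - 1)"
          by (simp add: powr_diff twoL \<open>d = 3\<close>)
        also have "\<dots> \<le> M" unfolding M_def using 2 L1 by (intro powr_mono2) auto
        finally have M: "9 / 4 \<le> M" .
        then have "N * (9 / 4) \<le> N * M" using N0 by (intro mult_left_mono) auto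
        then show ?thesis using M 3 by simp
      qed
      then show ?thesis using lhs 3 by (simp add: algebra_simps)
    qed
  qed
  also have "\<dots> = N powr L - 2 * (1 + (N - d) * M / d)"
    using d by (simp add: NL field_simps)
  also have "\<dots> \<le> N powr L - 2 * (1 + ((N - d) / 2) powr L)" using half by simp
  finally show ?thesis unfolding L_def by simp
qed

text \<open>
With thresholds \<open>n div 2\<close> and \<open>(n - 1) div 2\<close>, whose sum is \<open>n - 1\<close>, the recurrence is sharp enough for
\<open>d = 2\<close>, where the bound \<open>n - 2\<close> is reproduced exactly; taking \<open>n div 2\<close> twice would lose one for
even \<open>n\<close>.
\<close>

lemma todd_recurrence:
  assumes "2 \<le> d" "d \<le> n"
  shows "todd_bound (d - 1) (n - 1)
      + (if d \<le> n div 2 then todd_bound d (n div 2) + 1 else 0)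
      + (if d \<le> (n - 1) div 2 then todd_bound d ((n - 1) div 2) + 1 else 0)
    \<le> todd_bound d n"
proof -
  let ?m = "n div 2" and ?k = "(n - 1) div 2"
  have first: "todd_bound (d - 1) (n - 1) = (real n - real d) powr log 2 (real d - 1)"
    using assms by (simp add: todd_bound_def of_nat_diff)
  consider "?m < d" | "d \<le> ?m" "d = 2" | "d \<le> ?m" "3 \<le> d" using assms by linarith
  then show ?thesis
  proof cases
    case 1
    then have "\<not> d \<le> ?m" "\<not> d \<le> ?k" by auto
    moreover have "(real n - real d) powr log 2 (real d - 1) \<le> (real n - real d) powr log 2 (real d)"
    proof (cases "n = d")
      case False
      then have "1 \<le> real n - real d" using assms by linarith
      then show ?thesis using assms by (intro powr_mono) auto
    qed simp
    ultimately show ?thesis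
      unfolding first todd_bound_def[of d n] by (simp only: if_False add_0_right)
  next
    case 2
    have two: "todd_bound 2 m = real m - 2" if "2 \<le> m" for m
      using that by (simp add: todd_bound_def)
    have one: "(real n - real d) powr log 2 (real d - 1) = 1" using 2 by simp
    have n4: "4 \<le> n" using 2 by linarith
    show ?thesis
    proof (cases "n = 4")
      case True
      then show ?thesis unfolding first one using 2(2) two[of 2] two[of 4] by simp
    next
      case False
      then have k: "2 \<le> ?k" using n4 by linarith
      have "?m + ?k + 1 = n" using n4 by linarith
      then have "real ?m + real ?k + 1 = real n" by linarith
      then show ?thesis
        unfolding first one using 2 k two[of ?m] two[of ?k] two[of n] n4 by simp
    qed
  next
    case 3
    have half: "todd_bound d i \<le> ((real n - real d - real d) / 2) powr log 2 (real d)"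
      if "d \<le> i" "2 * i \<le> n" for i
    proof -
      have "2 * real i \<le> real n" using that by (metis of_nat_le_iff of_nat_mult of_nat_numeral)
      then show ?thesis
        unfolding todd_bound_def using that 3 by (intro powr_mono2) auto
    qed
    let ?h = "((real n - real d - real d) / 2) powr log 2 (real d)"
    have n2: "2 * d \<le> n" using 3 by linarith
    have "(if d \<le> ?m then todd_bound d ?m + 1 else 0) \<le> 1 + ?h" using half[of ?m] by simp
    moreover have "(if d \<le> ?k then todd_bound d ?k + 1 else 0) \<le> 1 + ?h"
    proof -
      have "2 * ?k \<le> n" by linarith
      then show ?thesis using half[of ?k] by (simp add: add_nonneg_nonneg)
    qed
    moreover have "(real n - real d) powr log 2 (real d - 1) + 2 * (1 + ?h)
        \<le> (real n - real d) powr log 2 (real d)"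
    proof (rule power_estimate)
      show "3 \<le> real d" "real d \<le> real n - real d" using 3 n2 by linarith+
      show "real d = 3 \<and> (real n - real d = 3 \<or> 4 \<le> real n - real d)" if "real d < 4"
      proof -
        have "d = 3" using that 3 by linarith
        then show ?thesis using n2 by (cases "n = 6") auto
      qed
    qed
    ultimately show ?thesis unfolding first by (simp add: todd_bound_def[of d n])
  qed
qed

section \<open>The Kalai-Kleitman recurrence for diameters\<close>

lemma relpow_mono_rel:
  fixes R S :: "('a \<times> 'a) set"
  assumes "R \<subseteq> S" shows "R ^^ k \<subseteq> S ^^ k"
  using assms by (induction k) (auto simp: relcomp_mono)

text \<open>
The constraints near \<open>v\<close> and those near \<open>w\<close> are collected until there are more than \<open>p\<close>, respectively
more than \<open>q\<close>, of them. Then the two collections together exceed \<open>n\<close>, so some constraint occurs in both,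
and its facet contains a vertex near \<open>v\<close> and a vertex near \<open>w\<close>. Two vertices of a facet are joined
within it, in dimension \<open>d - 1\<close> and with the defining constraint no longer counted.
\<close>

lemma diameter_recurrence:
  fixes C :: real
  assumes d: "2 \<le> d"
    and facets: "diam_le TYPE('a::euclidean_space) (d - 1) (n - 1) F"
    and relax1: "d \<le> p \<Longrightarrow> diam_le TYPE('a) d p X" "0 \<le> X"
    and relax2: "d \<le> q \<Longrightarrow> diam_le TYPE('a) d q Y" "0 \<le> Y"
    and size: "n \<le> p + q + 1"
    and C: "F + (if d \<le> p then X + 1 else 0) + (if d \<le> q then Y + 1 else 0) \<le> C"
    and C2: "d \<le> p \<Longrightarrow> X \<le> C" "d \<le> q \<Longrightarrow> Y \<le> C"
  shows "diam_le TYPE('a) d n C"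
  unfolding diam_le_def
proof (intro allI impI, elim conjE)
  fix A :: "'a set" and I v w
  assume A: "affine A" "aff_dim A = int d" and fin: "finite I" and card: "card I \<le> n"
    and proper: "\<forall>a b. (a, b) \<in> I \<longrightarrow> \<not> A \<subseteq> {x. a \<bullet> x = b}"
    and v: "v extreme_point_of feasible A I" and w: "w extreme_point_of feasible A I"
  let ?E = "edges (feasible A I)"
  have proper': "\<And>a b. (a, b) \<in> I \<Longrightarrow> \<not> A \<subseteq> {x. a \<bullet> x = b}" using proper by blast
  have ex: "\<exists>k. (v, w) \<in> ?E ^^ k"
    using rtrancl_imp_relpow[OF extreme_points_connected[OF A(1) fin v w]] .
  define D where "D = (LEAST k. (v, w) \<in> ?E ^^ k)"
  have D: "(v, w) \<in> ?E ^^ D" using ex unfolding D_def by (rule LeastI_ex)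
  have Dle: "D \<le> j" if "(v, w) \<in> ?E ^^ j" for j using that unfolding D_def by (rule Least_le)
  have D': "(w, v) \<in> ?E ^^ D" using D by (rule relpow_edges_sym)
  have Dle': "D \<le> j" if "(w, v) \<in> ?E ^^ j" for j using Dle[OF relpow_edges_sym[OF that]] .
  note near_v = many_constraints_near[OF A fin proper' v D Dle relax1]
  note near_w = many_constraints_near[OF A fin proper' w D' Dle' relax2]
  show "\<exists>k. real k \<le> C \<and> (v, w) \<in> ?E ^^ k"
  proof (cases "real D \<le> C")
    case True
    then show ?thesis using D by blast
  next
    case False
    obtain k where k: "p < card (tight_near A I v k)" "real k \<le> (if d \<le> p then X + 1 else 0)"
      using near_v False C2(1) by auto
    obtain l where l: "q < card (tight_near A I w l)" "real l \<le> (if d \<le> q then Y + 1 else 0)"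
      using near_w False C2(2) by auto
    let ?V = "tight_near A I v k" and ?W = "tight_near A I w l"
    have finV: "finite ?V" "finite ?W" by (rule finite_subset[OF tight_near_subset fin])+
    have "?V \<inter> ?W \<noteq> {}"
    proof
      assume "?V \<inter> ?W = {}"
      then have "card ?V + card ?W = card (?V \<union> ?W)" using finV by (simp add: card_Un_disjoint)
      also have "\<dots> \<le> card I" using tight_near_subset[of A I] by (intro card_mono fin) auto
      finally show False using k(1) l(1) size card by linarith
    qed
    then obtain a b where ab: "(a, b) \<in> ?V" "(a, b) \<in> ?W" by auto
    obtain i x where x: "i \<le> k" "(v, x) \<in> ?E ^^ i" "(a, b) \<in> tight I x"
      using ab(1) unfolding tight_near_def by blast
    obtain j y where y: "j \<le> l" "(w, y) \<in> ?E ^^ j" "(a, b) \<in> tight I y"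
      using ab(2) unfolding tight_near_def by blast
    have abI: "(a, b) \<in> I" and ax: "a \<bullet> x = b" and ay: "a \<bullet> y = b" using x y by (auto simp: in_tight)
    have x_ext: "x extreme_point_of feasible A I" and y_ext: "y extreme_point_of feasible A I"
      using relpow_edges_extreme x(2) y(2) v w by blast+
    then have xP: "x \<in> feasible A I" and yP: "y \<in> feasible A I" by (auto simp: extreme_point_of_def)
    let ?A = "A \<inter> {z. a \<bullet> z = b}"
    \<comment> \<open>On the hyperplane of the facet some constraints may turn into equations; discarding them keeps the facet
    and restores the nondegeneracy required of the system.\<close>
    define J where "J = {(a', b'). (a', b') \<in> I - {(a, b)} \<and> \<not> ?A \<subseteq> {z. a' \<bullet> z = b'}}"
    have JI: "J \<subseteq> I - {(a, b)}" by (auto simp: J_def)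
    have finJ: "finite J" using JI fin by (rule_tac finite_subset[OF JI]) simp
    have "card J \<le> card (I - {(a, b)})" using JI fin by (intro card_mono) auto
    then have cardJ: "card J \<le> n - 1" using abI fin card by (simp add: card_Diff_singleton)
    have feasJ: "feasible ?A J = feasible ?A I"
    proof
      show "feasible ?A I \<subseteq> feasible ?A J" using JI by (auto simp: feasible_def)
      show "feasible ?A J \<subseteq> feasible ?A I"
      proof
        fix z assume z: "z \<in> feasible ?A J"
        have "a' \<bullet> z \<le> b'" if "(a', b') \<in> I" for a' b'
        proof (cases "(a', b') \<in> J")
          case True
          then show ?thesis using z by (auto simp: feasible_def)
        next
          case False
          then have "(a', b') = (a, b) \<or> ?A \<subseteq> {z. a' \<bullet> z = b'}" using that by (auto simp: J_def)
          then show ?thesis using z by (auto simp: feasible_def)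
        qed
        then show "z \<in> feasible ?A I" using z by (simp add: feasible_def)
      qed
    qed
    have face: "feasible ?A I face_of feasible A I" by (rule facet_face_of[OF A(1) fin abI])
    have "aff_dim ?A = int (d - 1)"
      using aff_dim_affine_Int_hyperplane[OF A(1), of a b] proper'[OF abI] A(2) d xP ax
      by (auto simp: feasible_def of_nat_diff)
    moreover have "affine ?A" using A(1) by (intro affine_Int affine_hyperplane)
    moreover have "\<not> ?A \<subseteq> {z. a' \<bullet> z = b'}" if "(a', b') \<in> J" for a' b' using that by (simp add: J_def)
    moreover have "x extreme_point_of feasible ?A J" "y extreme_point_of feasible ?A J"
      unfolding feasJ extreme_point_of_face[OF face] using x_ext y_ext xP yP ax ay by (auto simp: facet_eq)
    ultimately obtain r where r: "real r \<le> F" "(x, y) \<in> edges (feasible ?A J) ^^ r"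
      using diam_leD[OF facets, of ?A J x y] finJ cardJ by metis
    have "(x, y) \<in> ?E ^^ r" using r(2) relpow_mono_rel[OF edges_face[OF face]] unfolding feasJ by blast
    then have "(v, w) \<in> ?E ^^ (i + r + j)"
      using relpow_trans[OF relpow_trans[OF x(2)] relpow_edges_sym[OF y(2)]] by blast
    moreover have "real (i + r + j) \<le> C" using x(1) y(1) k(2) l(2) r(1) C by simp
    ultimately show ?thesis by blast
  qed
qed

text \<open>
On a line, two distinct vertices span the whole polyhedron, so they are adjacent; each needs a tight
constraint of its own, so \<open>n \<ge> 2\<close> and the bound is \<open>1\<close>.
\<close>

lemma diameter_line: "diam_le TYPE('a::euclidean_space) 1 n (todd_bound 1 n)"
  unfolding diam_le_def
proof (intro allI impI, elim conjE)
  fix A :: "'a set" and I v w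
  assume A: "affine A" "aff_dim A = int 1" and fin: "finite I" and card: "card I \<le> n"
    and proper: "\<forall>a b. (a, b) \<in> I \<longrightarrow> \<not> A \<subseteq> {x. a \<bullet> x = b}"
    and v: "v extreme_point_of feasible A I" and w: "w extreme_point_of feasible A I"
  let ?P = "feasible A I"
  show "\<exists>k. real k \<le> todd_bound 1 n \<and> (v, w) \<in> edges ?P ^^ k"
  proof (cases "v = w")
    case True
    then show ?thesis by (intro exI[of _ 0]) (simp add: todd_bound_nonneg)
  next
    case False
    have vP: "v \<in> ?P" and wP: "w \<in> ?P" using v w by (auto simp: extreme_point_of_def)
    then have vA: "v \<in> A" and wA: "w \<in> A" by (auto simp: feasible_def)
    have hull: "affine hull {v, w} = A"
    proof (rule affine_dim_equal)
      show "affine hull {v, w} \<subseteq> A" using vA wA A by (intro hull_minimal) auto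
      show "aff_dim (affine hull {v, w}) = aff_dim A" using False A(2) by (simp add: aff_dim_2)
    qed (use A in auto)
    have disj: "tight I v \<inter> tight I w = {}"
    proof (rule ccontr)
      assume "tight I v \<inter> tight I w \<noteq> {}"
      then obtain a b where ab: "(a, b) \<in> I" "a \<bullet> v = b" "a \<bullet> w = b" by (auto simp: tight_def)
      then have "affine hull {v, w} \<subseteq> {x. a \<bullet> x = b}"
        by (intro hull_minimal) (auto simp: affine_hyperplane)
      then show False using proper ab(1) hull by blast
    qed
    have finT: "finite (tight I v)" "finite (tight I w)" by (rule finite_subset[OF tight_subset fin])+
    have "1 \<le> card (tight I v)" "1 \<le> card (tight I w)"
      using card_tight_ge[OF A(1) fin v] card_tight_ge[OF A(1) fin w] A(2) by auto
    then have "2 \<le> card (tight I v \<union> tight I w)" using finT disj by (simp add: card_Un_disjoint)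
    also have "\<dots> \<le> card I" using tight_subset[of I] by (intro card_mono fin) auto
    finally have "2 \<le> n" using card by simp
    then have bound: "todd_bound 1 n = 1" by (simp add: todd_bound_def)
    have seg: "?P = closed_segment v w"
    proof
      show "closed_segment v w \<subseteq> ?P" using convex_feasible[OF A(1) fin] vP wP by (simp add: closed_segment_subset)
      show "?P \<subseteq> closed_segment v w"
      proof
        fix x assume x: "x \<in> ?P"
        have "x \<in> affine hull {v, w}" using x hull by (simp add: feasible_def)
        then have "collinear {x, v, w}"
          by (metis collinear_3_affine_hull False insert_commute)
        then consider "x \<in> closed_segment v w" | "v \<in> closed_segment w x" | "w \<in> closed_segment x v"
          by (auto simp: collinear_between_cases between_mem_segment closed_segment_commute)
        then show "x \<in> closed_segment v w"
        proof cases
          case 2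
          then have "v = x" using v wP x False by (auto simp: extreme_point_of_def open_segment_def)
          then show ?thesis by simp
        next
          case 3
          then have "w = x" using w vP x False by (auto simp: extreme_point_of_def open_segment_def)
          then show ?thesis by simp
        qed
      qed
    qed
    have "(v, w) \<in> edges ?P"
      using False by (simp add: edges_def seg extreme_point_of_segment face_of_refl)
    then show ?thesis using bound by (intro exI[of _ 1]) simp
  qed
qed

theorem diameter_feasible_le:
  assumes "1 \<le> d" "d \<le> n"
  shows "diam_le TYPE('a::euclidean_space) d n (todd_bound d n)"
  using assms
proof (induction n arbitrary: d rule: less_induct)
  case (less n)
  show ?case
  proof (cases "d = 1")
    case True
    then show ?thesis using diameter_line less.prems by blast
  next
    case False
    then have d: "2 \<le> d" using less.prems by simp
    let ?m1 = "n div 2" and ?m2 = "(n - 1) div 2"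
    show ?thesis
    proof (rule diameter_recurrence[where F = "todd_bound (d - 1) (n - 1)" and p = "?m1"
          and q = "?m2" and X = "todd_bound d ?m1" and Y = "todd_bound d ?m2"])
      show "diam_le TYPE('a) (d - 1) (n - 1) (todd_bound (d - 1) (n - 1))"
        by (rule less.IH) (use d less.prems in auto)
      show "diam_le TYPE('a) d ?m1 (todd_bound d ?m1)" if "d \<le> ?m1"
        by (rule less.IH) (use that d less.prems in auto)
      show "diam_le TYPE('a) d ?m2 (todd_bound d ?m2)" if "d \<le> ?m2"
        by (rule less.IH) (use that d less.prems in auto)
      show "n \<le> ?m1 + ?m2 + 1" using d less.prems by presburger
    qed (use d less.prems todd_recurrence[OF d] in \<open>auto simp: todd_bound_nonneg todd_bound_mono\<close>)
  qed
qed

section \<open>Vertices and adjacency as sections by half-spaces\<close>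

text \<open>
Faces of polyhedra are exposed, so a half-space supporting \<open>P\<close> along \<open>F\<close> and facing away from \<open>P\<close> cuts
out \<open>F\<close>. Only for \<open>F = P\<close> can the exposing functional vanish; compactness then gives a half-space that
contains all of \<open>P\<close>.
\<close>

lemma compact_face_is_cut:
  fixes P :: "'a::euclidean_space set"
  assumes P: "polyhedron P" and F: "F face_of P" "compact F" "F \<noteq> {}"
  shows "\<exists>H. halfspace H \<and> P \<inter> H = F"
proof -
  have "F exposed_face_of P" using exposed_face_of_polyhedron[OF P] F(1) by simp
  then obtain a b where ab: "P \<subseteq> {x. a \<bullet> x \<le> b}" "F = P \<inter> {x. a \<bullet> x = b}"
    by (auto simp: exposed_face_of_def)
  show ?thesis
  proof (cases "a = 0")
    case False
    have "P \<inter> {x. (- a) \<bullet> x \<le> - b} = F" using ab by fastforce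
    then show ?thesis using False unfolding halfspace_def by (metis neg_equal_0_iff_equal)
  next
    case True
    then have "F = P" using ab F(3) by auto
    then obtain r where r: "\<And>x. x \<in> P \<Longrightarrow> norm x \<le> r"
      using compact_imp_bounded[OF F(2)] by (auto simp: bounded_iff)
    let ?e = "SOME e::'a. e \<in> Basis"
    have e: "?e \<in> Basis" by (rule SOME_Basis)
    have "?e \<bullet> x \<le> r" if "x \<in> P" for x
      using norm_cauchy_schwarz[of ?e x] r[OF that] e by simp
    then have "P \<inter> {x. ?e \<bullet> x \<le> r} = F" using \<open>F = P\<close> by blast
    moreover have "halfspace {x. ?e \<bullet> x \<le> r}" unfolding halfspace_def using nonzero_Basis[OF e] by blast
    ultimately show ?thesis by blast
  qed
qed

text \<open>
If \<open>v\<close> lies strictly between two points of \<open>P\<close>, then one of them lies in any half-space containing \<open>v\<close>.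
\<close>

lemma vertex_imp_extreme:
  assumes "vertex P v"
  shows "v extreme_point_of P"
proof -
  obtain a b where vP: "v \<in> P" and cut: "P \<inter> {x. a \<bullet> x \<le> b} = {v}"
    using assms by (auto simp: vertex_def halfspace_def)
  have "v \<notin> open_segment y z" if yz: "y \<in> P" "z \<in> P" for y z
  proof
    assume v: "v \<in> open_segment y z"
    then obtain u where u: "0 < u" "u < 1" "v = (1 - u) *\<^sub>R y + u *\<^sub>R z" by (auto simp: in_segment)
    have "a \<bullet> v \<le> b" using cut by auto
    then have "(1 - u) * (a \<bullet> y) + u * (a \<bullet> z) \<le> b" by (simp add: u(3) inner_add_right)
    moreover have "b < (1 - u) * (a \<bullet> y) + u * (a \<bullet> z)" if "b < a \<bullet> y" "b < a \<bullet> z"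
    proof -
      have "(1 - u) * b < (1 - u) * (a \<bullet> y)" "u * b < u * (a \<bullet> z)" using that u by auto
      then show ?thesis by (simp add: algebra_simps)
    qed
    ultimately have "a \<bullet> y \<le> b \<or> a \<bullet> z \<le> b" by fastforce
    then have "y = v \<or> z = v" using cut yz by blast
    then show False using v by (auto simp: open_segment_def)
  qed
  then show ?thesis using vP by (auto simp: extreme_point_of_def)
qed

lemma extreme_imp_vertex:
  assumes "polyhedron P" "v extreme_point_of P"
  shows "vertex P v"
  using compact_face_is_cut[OF assms(1), of "{v}"] assms(2)
  by (auto simp: vertex_def face_of_singleton extreme_point_of_def)

lemma edges_imp_adjacent:
  assumes "polyhedron P" "(x, y) \<in> edges P"
  shows "adjacent P x y"
  using compact_face_is_cut[OF assms(1), of "closed_segment x y"] assms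
  by (auto simp: adjacent_def edges_def extreme_imp_vertex)

lemma relpow_edges_imp_vertex_path:
  assumes P: "polyhedron P" and "vertex P v" and k: "(v, w) \<in> edges P ^^ k"
  shows "vertex_path P k v w"
proof -
  obtain p where p: "p 0 = v" "p k = w" "\<forall>i<k. (p i, p (Suc i)) \<in> edges P"
    using k by (auto simp: relpow_fun_conv)
  have adj: "adjacent P (p (i - 1)) (p i)" if "i \<in> {1..k}" for i
  proof -
    have "i - 1 < k" "Suc (i - 1) = i" using that by auto
    then show ?thesis using p(3) edges_imp_adjacent[OF P] by metis
  qed
  have "vertex P (p i)" if "i \<le> k" for i
    using assms(2) p(1) adj[of i] that by (cases i) (auto simp: adjacent_def)
  then show ?thesis unfolding vertex_path_def using p adj by blast
qed

lemma Inter_of_halfspaces_feasible: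
  assumes "Inter_of_halfspaces n P"
  obtains I where "finite I" "card I \<le> n" "P = feasible UNIV I"
    "\<And>a b. (a, b) \<in> I \<Longrightarrow> \<not> UNIV \<subseteq> {x. a \<bullet> x = b}"
proof -
  obtain F where F: "finite F" "card F = n" "\<forall>H\<in>F. halfspace H" "P = \<Inter>F"
    using assms by (auto simp: Inter_of_halfspaces_def)
  have "\<forall>H\<in>F. \<exists>q. fst q \<noteq> 0 \<and> H = {x. fst q \<bullet> x \<le> snd q}"
    using F(3) by (force simp: halfspace_def)
  then obtain q where q: "\<And>H. H \<in> F \<Longrightarrow> fst (q H) \<noteq> 0 \<and> H = {x. fst (q H) \<bullet> x \<le> snd (q H)}"
    by metis
  show ?thesis
  proof
    show "finite (q ` F)" "card (q ` F) \<le> n" using F card_image_le by auto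
    show "P = feasible UNIV (q ` F)"
    proof -
      have "x \<in> \<Inter>F \<longleftrightarrow> (\<forall>H\<in>F. fst (q H) \<bullet> x \<le> snd (q H))" for x using q by blast
      then show ?thesis unfolding F(4) feasible_eq_Inter by auto
    qed
    show "\<not> UNIV \<subseteq> {x. a \<bullet> x = b}" if "(a, b) \<in> q ` F" for a b
    proof
      assume *: "UNIV \<subseteq> {x. a \<bullet> x = b}"
      then have "a \<bullet> 0 = b" "a \<bullet> a = b" by blast+
      moreover have "a \<noteq> 0" using that q by (metis fst_conv imageE)
      ultimately show False by simp
    qed
  qed
qed

lemma vertex_dist_le:
  fixes P :: "'a::euclidean_space set"
  assumes "Inter_of_halfspaces n P" "DIM('a) \<le> n" "vertex P v" "vertex P w"
  shows "\<exists>k. real k \<le> todd_bound DIM('a) n \<and> vertex_dist P v w \<le> enat k"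
proof -
  obtain I where I: "finite I" "card I \<le> n" "P = feasible UNIV I"
    "\<And>a b. (a, b) \<in> I \<Longrightarrow> \<not> UNIV \<subseteq> {x. a \<bullet> x = b}"
    using Inter_of_halfspaces_feasible[OF assms(1)] by metis
  have "diam_le TYPE('a) DIM('a) n (todd_bound DIM('a) n)"
    using assms(2) by (intro diameter_feasible_le) (auto simp: DIM_positive Suc_leI)
  from diam_leD[OF this affine_UNIV aff_dim_UNIV I(1,2,4)]
  obtain k where k: "real k \<le> todd_bound DIM('a) n" "(v, w) \<in> edges P ^^ k"
    using assms(3,4) I(3) vertex_imp_extreme by metis
  have "polyhedron P" using polyhedron_feasible[OF affine_UNIV I(1)] I(3) by simp
  from relpow_edges_imp_vertex_path[OF this assms(3) k(2)]
  have "vertex_dist P v w \<le> enat k" unfolding vertex_dist_def by (intro Inf_lower) auto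
  then show ?thesis using k(1) by blast
qed

theorem theorem1:
  fixes d n :: nat
  assumes "CARD('d::finite) = d"
    and "1 \<le> d" and "d \<le> n"
  shows "ereal_of_enat (max_diameter TYPE('d) n) \<le>
    ereal (if d = 1 \<and> n = 1 then 0 else (real n - real d) powr log 2 (real d))"
proof -
  have dim: "DIM(real^'d) = d" using assms(1) by simp
  \<comment> \<open>Distances are extended naturals, so the real bound is first rounded down to an integer.\<close>
  let ?N = "nat \<lfloor>todd_bound d n\<rfloor>"
  have "vertex_dist P v w \<le> enat ?N"
    if P: "dn_polyhedron n P" "vertex P v" "vertex P w" for P :: "(real^'d) set" and v w
  proof -
    obtain k where k: "real k \<le> todd_bound d n" "vertex_dist P v w \<le> enat k"
      using vertex_dist_le[of n P v w] P assms(3) unfolding dim by (auto simp: dn_polyhedron_def)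
    have "k \<le> ?N" using k(1) by (simp add: le_nat_floor)
    then show ?thesis using k(2) by (meson enat_ord_simps(1) order_trans)
  qed
  then have "max_diameter TYPE('d) n \<le> enat ?N"
    unfolding max_diameter_def poly_diameter_def by (auto intro!: Sup_least)
  then have "ereal_of_enat (max_diameter TYPE('d) n) \<le> ereal_of_enat (enat ?N)"
    by (simp only: ereal_of_enat_le_iff)
  also have "\<dots> = ereal (real ?N)" by simp
  also have "\<dots> \<le> ereal (todd_bound d n)" by (simp add: todd_bound_nonneg)
  also have "todd_bound d n = (if d = 1 \<and> n = 1 then 0 else (real n - real d) powr log 2 (real d))"
    by (simp add: todd_bound_def)
  finally show ?thesis .
qed

end
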